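(* Let the attributes of an embodied stream of $N$ keyframes with $d$ attributes each (the coordinates of the content vectors $c_1,\dots,c_N\in\{1,\dots,K\}^d$) be i.i.d. uniform on $\{1,\dots,K\}$, and let $A$ be any agent (of unbounded compute) whose only cross-frame memory is a state of $m$ bits. Then on the episodic retrieval task $T_{\mathrm{ret}}$ with per-frame query, $$\mathrm{err}(A)\;\ge\;1-\frac{m/(Nd)+1}{\log_2 K}.$$ In particular, with $b=d\log_2 K$, any $o(Nb)$-bit state forces $\mathrm{err}\to 1-\frac{1}{\log_2 K}$ as $N\to\infty$: constant-size scene memories (however semantically clever) cannot answer episodic-appearance queries about arbitrary past keyframes.
   Context: An embodied stream is a sequence $X=(x_1,\dots,x_N)$ of keyframes produced by an egocentric sensor; keyframe $x_i$ carries a salient content vector $c_i\in\{1,\dots,K\}^d$ (attribute values such as object identity, color, state, relative pose), so a keyframe holds $b=d\log_2K$ salient bits. Episodic retrieval task $T_{\mathrm{ret}}$: a query, issued at time $N$ (after the whole stream has been seen), asks the value of a uniformly chosen attribute of a uniformly chosen past keyframe. Equivalently, the query index $U$ is uniform on the $Nd$ (keyframe, attribute) pairs and independent of $c=(c_1,\dots,c_N)$, and the correct answer is the corresponding attribute value $c_U$. $\mathrm{err}(A)$ is the probability that the agent's answer differs from $c_U$. An agent whose only cross-frame memory is a state of $m$ bits: its state at query time is $S=\sigma(c)\in\{0,1\}^m$ for an arbitrary (possibly randomized, unbounded-compute) map $\sigma$, formed without knowledge of the query, and its answer is $\psi(S,U)$ for an arbitrary map $\psi$; any randomness is independent of $c$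 and $U$ and is handled by conditioning on the seed.
   Formalization: The claim that err tends to 1 − 1/log₂K is false (an always-wrong agent has err = 1); it is replaced by: the lower bound tends to 1 − 1/log₂K and liminf err ≥ 1 − 1/log₂K, for fixed K ≥ 2 and d ≥ 1. *)

theory Defs
  imports "HOL-Probability.Probability" "HOL-Library.Landau_Symbols"
begin

text \<open>The pair \<open>(i, j)\<close> stands for attribute \<open>j\<close> of keyframe \<open>i\<close>; a stream \<open>c\<close> maps it to the
  attribute value, so the content vector of keyframe \<open>i\<close> is \<open>\<lambda>j. c (i, j)\<close>.\<close>

type_synonym embodied_stream = "nat \<times> nat \<Rightarrow> nat"

definition attributes :: "nat \<Rightarrow> nat \<Rightarrow> (nat \<times> nat) set" where
  "attributes N d = {1..N} \<times> {1..d}"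

definition keyframe_space :: "nat \<Rightarrow> nat \<Rightarrow> nat \<Rightarrow> embodied_stream measure" where
  "keyframe_space N d K = (\<Pi>\<^sub>M u\<in>attributes N d. uniform_count_measure {1..K})"

definition query_space :: "nat \<Rightarrow> nat \<Rightarrow> (nat \<times> nat) measure" where
  "query_space N d = uniform_count_measure (attributes N d)"

text \<open>The seed carries all the randomness of the agent and may be used both when the state is
  formed and when the query is answered. Deterministic agents are those ignoring the seed.\<close>

record 'r agent =
  seed_space :: "'r measure"
  encode :: "'r \<Rightarrow> embodied_stream \<Rightarrow> bool list"
  answer :: "'r \<Rightarrow> bool list \<Rightarrow> nat \<times> nat \<Rightarrow> nat"

definition memory_agent :: "nat \<Rightarrow> nat \<Rightarrow> nat \<Rightarrow> nat \<Rightarrow> 'r agent \<Rightarrow> bool" where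
  "memory_agent N d K m A \<longleftrightarrow>
     prob_space (seed_space A) \<and>
     (\<forall>c\<in>space (keyframe_space N d K).
        (\<lambda>r. encode A r c) \<in> seed_space A \<rightarrow>\<^sub>M count_space {s. length s = m}) \<and>
     (\<forall>s u. length s = m \<longrightarrow> u \<in> attributes N d \<longrightarrow>
        (\<lambda>r. answer A r s u) \<in> seed_space A \<rightarrow>\<^sub>M count_space UNIV)"

text \<open>Seed, stream and query are mutually independent.\<close>

definition task_space :: "nat \<Rightarrow> nat \<Rightarrow> nat \<Rightarrow> 'r agent \<Rightarrow> ('r \<times> embodied_stream \<times> (nat \<times> nat)) measure" where
  "task_space N d K A = seed_space A \<Otimes>\<^sub>M (keyframe_space N d K \<Otimes>\<^sub>M query_space N d)"

definition error_event :: "nat \<Rightarrow> nat \<Rightarrow> nat \<Rightarrow> 'r agent \<Rightarrow> ('r \<times> embodied_stream \<times> (nat \<times> nat)) set" where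
  "error_event N d K A =
     {(r, c, u) \<in> space (task_space N d K A). answer A r (encode A r c) u \<noteq> c u}"

definition err :: "nat \<Rightarrow> nat \<Rightarrow> nat \<Rightarrow> 'r agent \<Rightarrow> real" where
  "err N d K A = measure (task_space N d K A) (error_event N d K A)"

text \<open>\<open>measure\<close> is 0 on non-measurable sets; the next two lemmas show that \<open>err\<close> is a genuine
  probability.\<close>

lemma prob_space_task_space:
  assumes "memory_agent N d K m A" "N \<ge> 1" "d \<ge> 1" "K \<ge> 1"
  shows "prob_space (task_space N d K A)"
proof -
  interpret S: prob_space "seed_space A" using assms by (simp add: memory_agent_def)
  interpret C: prob_space "keyframe_space N d K"
    unfolding keyframe_space_def by (intro prob_space_PiM prob_space_uniform_count_measure) (use assms in auto)
  interpret Q: prob_space "query_space N d"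
    using assms unfolding query_space_def attributes_def
    by (intro prob_space_uniform_count_measure) auto
  interpret CQ: pair_prob_space "keyframe_space N d K" "query_space N d" ..
  interpret T: pair_prob_space "seed_space A" "keyframe_space N d K \<Otimes>\<^sub>M query_space N d" ..
  show ?thesis unfolding task_space_def by (rule T.prob_space_axioms)
qed

lemma error_event_measurable:
  assumes "memory_agent N d K m A"
  shows "error_event N d K A \<in> sets (task_space N d K A)"
proof -
  define CQ where "CQ = keyframe_space N d K \<Otimes>\<^sub>M query_space N d"
  have fin: "finite (attributes N d)" by (simp add: attributes_def)
  have "sets (keyframe_space N d K) = sets (\<Pi>\<^sub>M u\<in>attributes N d. count_space {1..K})"
    unfolding keyframe_space_def
    by (intro sets_PiM_cong) (auto simp: sets_uniform_count_measure)
  also have "\<dots> = sets (count_space (attributes N d \<rightarrow>\<^sub>E {1..K}))"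
    using fin by (subst count_space_PiM_finite) auto
  finally have sC: "sets (keyframe_space N d K) = Pow (attributes N d \<rightarrow>\<^sub>E {1..K})" by simp
  have spC: "space (keyframe_space N d K) = (attributes N d \<rightarrow>\<^sub>E {1..K})"
    by (simp add: keyframe_space_def space_PiM space_uniform_count_measure)
  have spQ: "space (query_space N d) = attributes N d"
    by (simp add: query_space_def space_uniform_count_measure)
  have sQ: "sets (query_space N d) = Pow (attributes N d)"
    by (simp add: query_space_def sets_uniform_count_measure)
  have fC: "finite (space (keyframe_space N d K))"
    using fin by (auto simp: spC intro!: finite_PiE)
  have spCQ: "space CQ = space (keyframe_space N d K) \<times> attributes N d"
    by (simp add: CQ_def space_pair_measure spQ)
  define B where "B c u = {r \<in> space (seed_space A). answer A r (encode A r c) u \<noteq> c u}" for c u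
  have B: "B c u \<in> sets (seed_space A)"
    if c: "c \<in> space (keyframe_space N d K)" and u: "u \<in> attributes N d" for c u
  proof -
    have e: "(\<lambda>r. encode A r c) \<in> seed_space A \<rightarrow>\<^sub>M count_space {s. length s = m}"
      using assms c by (simp add: memory_agent_def)
    have finb: "finite {s :: bool list. length s = m}"
      using finite_lists_length_eq[of "UNIV :: bool set" m] by simp
    have len: "length (encode A r c) = m" if "r \<in> space (seed_space A)" for r
      using measurable_space[OF e that] by simp
    have eq: "B c u = (\<Union>s\<in>{s. length s = m}.
        ((\<lambda>r. encode A r c) -` {s} \<inter> space (seed_space A)) \<inter>
        ((\<lambda>r. answer A r s u) -` (- {c u}) \<inter> space (seed_space A)))"
      using len by (auto simp: B_def)
    show ?thesis unfolding eq
    proof (rule sets.finite_UN[OF finb], rule sets.Int)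
      fix s :: "bool list" assume s: "s \<in> {s. length s = m}"
      show "(\<lambda>r. encode A r c) -` {s} \<inter> space (seed_space A) \<in> sets (seed_space A)"
        using s by (intro measurable_sets[OF e]) auto
      have "(\<lambda>r. answer A r s u) \<in> seed_space A \<rightarrow>\<^sub>M count_space UNIV"
        using assms s u unfolding memory_agent_def by blast
      then show "(\<lambda>r. answer A r s u) -` (- {c u}) \<inter> space (seed_space A) \<in> sets (seed_space A)"
        by (rule measurable_sets) auto
    qed
  qed
  have "error_event N d K A = (\<Union>(c, u)\<in>space CQ. B c u \<times> ({c} \<times> {u}))"
    by (auto simp: error_event_def task_space_def CQ_def[symmetric] space_pair_measure B_def)
  also have "\<dots> \<in> sets (seed_space A \<Otimes>\<^sub>M CQ)"
  proof (rule sets.finite_UN)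
    show "finite (space CQ)" using fC fin by (simp add: spCQ)
    fix x assume "x \<in> space CQ"
    then obtain c u where x: "x = (c, u)" and c: "c \<in> space (keyframe_space N d K)"
      and u: "u \<in> attributes N d" by (auto simp: spCQ)
    have "{c} \<times> {u} \<in> sets CQ"
      unfolding CQ_def using c u by (intro pair_measureI) (auto simp: sC sQ spC)
    then show "(case x of (c, u) \<Rightarrow> B c u \<times> ({c} \<times> {u})) \<in> sets (seed_space A \<Otimes>\<^sub>M CQ)"
      unfolding x using B[OF c u] by (auto intro: pair_measureI)
  qed
  finally show ?thesis by (simp add: task_space_def CQ_def)
qed

end

theory Submission
  imports Defs "HOL-Real_Asymp.Real_Asymp"
begin

text \<open>Fix the seed, put \<open>n = N d\<close> and let \<open>a(c)\<close> be the number of attributes of the stream \<open>c\<close>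
  that are answered correctly. Bounding \<open>K\<^sup>a\<^sup>(\<^sup>c\<^sup>)\<close> by the sum, over all \<open>2\<^sup>m\<close> states, of the same
  expression for the answer table of that state, and using independence of the attributes, one
  gets \<open>E K\<^sup>a \<le> 2\<^sup>m ((2K - 1) / K)\<^sup>n \<le> 2\<^sup>m\<^sup>+\<^sup>n\<close>. Jensen's inequality then yields
  \<open>E a \<sqdot> log\<^sub>2 K \<le> m + n\<close>, without any appeal to entropy, and averaging over the seed finishes
  the proof.\<close>

section \<open>Counting correct answers over all streams\<close>

text \<open>For a fixed table \<open>g\<close>, the events \<open>g u = c u\<close> are independent
  under a uniform \<open>c\<close>, so the exponential sum factorises over the coordinates. With
  \<open>K = card B\<close>, a factor is \<open>2K - 1\<close> if \<open>g u\<close> lies in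
  \<open>B\<close> and \<open>K\<close> otherwise.\<close>

lemma sum_power_card_agree_le:
  fixes g :: "'a \<Rightarrow> 'b"
  assumes "finite I" "finite B"
  shows "(\<Sum>c\<in>I \<rightarrow>\<^sub>E B. real (card B) ^ card {u \<in> I. g u = c u}) \<le> (2 * real (card B)) ^ card I"
proof -
  let ?K = "real (card B)"
  have "(\<Sum>c\<in>I \<rightarrow>\<^sub>E B. ?K ^ card {u \<in> I. g u = c u})
      = (\<Sum>c\<in>I \<rightarrow>\<^sub>E B. \<Prod>u\<in>I. if g u = c u then ?K else 1)"
    using assms by (simp add: prod.If_cases Int_def)
  also have "\<dots> = (\<Prod>u\<in>I. \<Sum>x\<in>B. if g u = x then ?K else 1)"
    using assms by (subst prod_sum_PiE) auto
  also have "\<dots> \<le> (\<Prod>u\<in>I. 2 * ?K)"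
  proof (intro prod_mono conjI sum_nonneg)
    fix u
    \<comment> \<open>At most one \<open>x\<close> equals \<open>g u\<close>, so the first summand
      totals at most \<open>K\<close>, and the ones total \<open>K\<close>.\<close>
    have "(\<Sum>x\<in>B. if g u = x then ?K else 1) \<le> (\<Sum>x\<in>B. (if g u = x then ?K else 0) + 1)"
      by (intro sum_mono) auto
    also have "\<dots> \<le> 2 * ?K"
      using assms by (simp add: sum.distrib)
    finally show "(\<Sum>x\<in>B. if g u = x then ?K else 1) \<le> 2 * ?K" .
  qed auto
  finally show ?thesis by simp
qed

text \<open>The table \<open>g (e c)\<close> depends on \<open>c\<close>, which blocks the
  factorisation; summing over all states in \<open>S\<close> decouples the two at the price of a
  factor \<open>card S\<close>, that is, of \<open>log 2 (card S)\<close> after taking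
  logarithms.\<close>

lemma sum_card_agree_le:
  fixes e :: "('a \<Rightarrow> 'b) \<Rightarrow> 's" and g :: "'s \<Rightarrow> 'a \<Rightarrow> 'b"
  assumes fin: "finite I" "finite B" "finite S" and "B \<noteq> {}"
    and e: "\<And>c. c \<in> I \<rightarrow>\<^sub>E B \<Longrightarrow> e c \<in> S"
  shows "(\<Sum>c\<in>I \<rightarrow>\<^sub>E B. real (card {u \<in> I. g (e c) u = c u})) * log 2 (card B)
      \<le> real (card (I \<rightarrow>\<^sub>E B)) * (log 2 (card S) + card I)"
proof -
  define K where "K = real (card B)"
  define n where "n = card I"
  \<comment> \<open>\<open>C\<close> bounds the average of \<open>K ^ ?a c\<close>: a factor
    \<open>card S\<close> for the decoupling and, after division by the \<open>K ^ n\<close>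
    streams, a factor 2 per coordinate.\<close>
  define C where "C = real (card S) * 2 ^ n"
  let ?a = "\<lambda>c. card {u \<in> I. g (e c) u = c u}"
  have finP: "finite (I \<rightarrow>\<^sub>E B)" using fin by (simp add: finite_PiE)
  have card: "real (card (I \<rightarrow>\<^sub>E B)) = K ^ n"
    using fin by (simp add: card_PiE K_def n_def)
  have K: "K > 0" using fin \<open>B \<noteq> {}\<close> by (simp add: K_def card_gt_0_iff)
  have "I \<rightarrow>\<^sub>E B \<noteq> {}" using \<open>B \<noteq> {}\<close> by (simp add: PiE_eq_empty_iff)
  then have S: "card S > 0" using e fin by (fastforce simp: card_gt_0_iff)
  then have C: "C > 0" by (simp add: C_def)
  have "(\<Sum>c\<in>I \<rightarrow>\<^sub>E B. K ^ ?a c) \<le> (\<Sum>c\<in>I \<rightarrow>\<^sub>E B. \<Sum>s\<in>S. K ^ card {u \<in> I. g s u = c u})"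
    using K fin e by (intro sum_mono member_le_sum) auto
  also have "\<dots> = (\<Sum>s\<in>S. \<Sum>c\<in>I \<rightarrow>\<^sub>E B. K ^ card {u \<in> I. g s u = c u})"
    by (rule sum.swap)
  also have "\<dots> \<le> (\<Sum>s\<in>S. (2 * K) ^ n)"
    unfolding K_def n_def by (intro sum_mono sum_power_card_agree_le fin)
  also have "\<dots> = C * K ^ n" by (simp add: C_def power_mult_distrib)
  finally have moment: "(\<Sum>c\<in>I \<rightarrow>\<^sub>E B. K ^ ?a c) \<le> C * K ^ n" .
  \<comment> \<open>Jensen's inequality for \<open>ln\<close>, by the tangent at \<open>C\<close>\<close>
  have tangent: "real (?a c) * ln K \<le> K ^ ?a c / C - 1 + ln C" for c
    using ln_le_minus_one[of "K ^ ?a c / C"] K C by (simp add: ln_div ln_realpow)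
  have "(\<Sum>c\<in>I \<rightarrow>\<^sub>E B. real (?a c)) * ln K = (\<Sum>c\<in>I \<rightarrow>\<^sub>E B. real (?a c) * ln K)"
    by (rule sum_distrib_right)
  also have "\<dots> \<le> (\<Sum>c\<in>I \<rightarrow>\<^sub>E B. K ^ ?a c / C - 1 + ln C)"
    by (intro sum_mono tangent)
  also have "\<dots> = (\<Sum>c\<in>I \<rightarrow>\<^sub>E B. K ^ ?a c) / C + K ^ n * (ln C - 1)"
    by (simp add: sum.distrib sum_subtractf sum_divide_distrib card algebra_simps)
  \<comment> \<open>By \<open>moment\<close> the first term is at most \<open>K ^ n\<close>, which
    cancels the \<open>-1\<close> of the tangent; this is why the tangent is taken at
    \<open>C\<close>.\<close>
  also have "\<dots> \<le> K ^ n + K ^ n * (ln C - 1)"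
    using moment C by (simp add: field_simps)
  also have "\<dots> = K ^ n * (ln (card S) + n * ln 2)"
    using S by (simp add: C_def ln_mult ln_realpow algebra_simps)
  finally have *: "(\<Sum>c\<in>I \<rightarrow>\<^sub>E B. real (?a c)) * ln K \<le> K ^ n * (ln (card S) + n * ln 2)" .
  have "(\<Sum>c\<in>I \<rightarrow>\<^sub>E B. real (?a c)) * log 2 K \<le> K ^ n * (ln (card S) + n * ln 2) / ln 2"
    using divide_right_mono[OF *, of "ln 2"] by (simp add: log_def)
  also have "\<dots> = K ^ n * (log 2 (card S) + n)"
    by (simp add: log_def field_simps)
  finally show ?thesis unfolding card by (simp add: K_def n_def)
qed

section \<open>Uniform measures on finite products\<close>

text \<open>Turns i.i.d. uniform attributes into one uniform draw of a stream, so that probabilities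
  become ratios of cardinalities. Both sides are measures on a finite power set, hence determined by
  the mass of singletons.\<close>

lemma PiM_uniform_count_measure:
  assumes "finite I" "\<And>i. i \<in> I \<Longrightarrow> finite (A i)" "\<And>i. i \<in> I \<Longrightarrow> A i \<noteq> {}"
  shows "(\<Pi>\<^sub>M i\<in>I. uniform_count_measure (A i)) = uniform_count_measure (Pi\<^sub>E I A)"
proof (rule measure_eqI_finite)
  \<comment> \<open>the product locale and \<open>count_space_PiM_finite\<close> quantify over all indices, also those outside \<open>I\<close>\<close>
  define A' where "A' i = (if i \<in> I then A i else {undefined})" for i
  have A': "finite (A' i)" "A' i \<noteq> {}" for i
    using assms by (auto simp: A'_def)
  interpret product_prob_space "\<lambda>i. uniform_count_measure (A' i)" I
    by (intro product_prob_spaceI prob_space_uniform_count_measure A')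
  have eq: "(\<Pi>\<^sub>M i\<in>I. uniform_count_measure (A i)) = (\<Pi>\<^sub>M i\<in>I. uniform_count_measure (A' i))"
    by (intro PiM_cong) (auto simp: A'_def)
  have fin: "finite (Pi\<^sub>E I A)" using assms by (intro finite_PiE) auto
  show "finite (Pi\<^sub>E I A)" by (rule fin)
  have "sets (\<Pi>\<^sub>M i\<in>I. uniform_count_measure (A i)) = sets (\<Pi>\<^sub>M i\<in>I. count_space (A' i))"
    unfolding eq by (intro sets_PiM_cong) (auto simp: sets_uniform_count_measure)
  also have "\<dots> = Pow (Pi\<^sub>E I A')"
    using assms(1) A' by (subst count_space_PiM_finite) (auto intro: countable_finite)
  also have "Pi\<^sub>E I A' = Pi\<^sub>E I A"
    by (intro PiE_cong) (simp add: A'_def)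
  finally show "sets (\<Pi>\<^sub>M i\<in>I. uniform_count_measure (A i)) = Pow (Pi\<^sub>E I A)" .
  show "sets (uniform_count_measure (Pi\<^sub>E I A)) = Pow (Pi\<^sub>E I A)"
    by (rule sets_uniform_count_measure)
  fix c assume c: "c \<in> Pi\<^sub>E I A"
  \<comment> \<open>By extensionality \<open>{c}\<close> is the box of the singletons
    \<open>{c i}\<close>, so its mass is a product.\<close>
  have "emeasure (\<Pi>\<^sub>M i\<in>I. uniform_count_measure (A i)) {c}
      = emeasure (\<Pi>\<^sub>M i\<in>I. uniform_count_measure (A' i)) (Pi\<^sub>E I (\<lambda>i. {c i}))"
    unfolding eq using c by (subst PiE_singleton) (auto simp: PiE_def)
  also have "\<dots> = (\<Prod>i\<in>I. emeasure (uniform_count_measure (A' i)) {c i})"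
    using c assms(1) by (intro emeasure_PiM) (auto simp: sets_uniform_count_measure A'_def)
  also have "\<dots> = (\<Prod>i\<in>I. ennreal (1 / real (card (A i))))"
    using c assms by (intro prod.cong) (auto simp: emeasure_uniform_count_measure A'_def PiE_mem)
  also have "\<dots> = ennreal (1 / real (card (Pi\<^sub>E I A)))"
    using assms by (subst prod_ennreal) (auto simp: card_PiE prod_dividef)
  also have "\<dots> = emeasure (uniform_count_measure (Pi\<^sub>E I A)) {c}"
    using c fin by (simp add: emeasure_uniform_count_measure)
  finally show "emeasure (\<Pi>\<^sub>M i\<in>I. uniform_count_measure (A i)) {c}
      = emeasure (uniform_count_measure (Pi\<^sub>E I A)) {c}" .
qed

lemma pair_uniform_count_measure:
  assumes "finite A" "A \<noteq> {}" "finite B" "B \<noteq> {}"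
  shows "uniform_count_measure A \<Otimes>\<^sub>M uniform_count_measure B = uniform_count_measure (A \<times> B)"
proof (rule measure_eqI_finite)
  interpret B: prob_space "uniform_count_measure B"
    using assms by (intro prob_space_uniform_count_measure)
  have "sets (uniform_count_measure A \<Otimes>\<^sub>M uniform_count_measure B)
      = sets (count_space A \<Otimes>\<^sub>M count_space B)"
    by (intro sets_pair_measure_cong) (auto simp: sets_uniform_count_measure)
  also have "\<dots> = Pow (A \<times> B)"
    using assms by (subst pair_measure_countable) (auto simp: countable_finite)
  finally show "sets (uniform_count_measure A \<Otimes>\<^sub>M uniform_count_measure B) = Pow (A \<times> B)" .
  fix x assume "x \<in> A \<times> B"
  then obtain a b where x: "x = (a, b)" "a \<in> A" "b \<in> B" by auto
  have "emeasure (uniform_count_measure A \<Otimes>\<^sub>M uniform_count_measure B) ({a} \<times> {b})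
      = ennreal (1 / card A) * ennreal (1 / card B)"
    using x assms
    by (subst B.emeasure_pair_measure_Times)
       (auto simp: sets_uniform_count_measure emeasure_uniform_count_measure)
  also have "\<dots> = emeasure (uniform_count_measure (A \<times> B)) {x}"
    using x assms by (simp add: emeasure_uniform_count_measure ennreal_mult'[symmetric] card_cartesian_product)
  finally show "emeasure (uniform_count_measure A \<Otimes>\<^sub>M uniform_count_measure B) {x}
      = emeasure (uniform_count_measure (A \<times> B)) {x}"
    using x by simp
qed (use assms in \<open>auto simp: sets_uniform_count_measure\<close>)

section \<open>From counts to the error probability\<close>

text \<open>The case of a deterministic agent. Wrong pairs \<open>?W\<close> and right pairs
  \<open>?R\<close> partition the stream-query grid, and \<open>?R\<close>, counted stream by
  stream, is bounded by \<open>sum_card_agree_le\<close>.\<close>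

lemma measure_disagree_ge:
  fixes e :: "('a \<Rightarrow> 'b) \<Rightarrow> 's" and g :: "'s \<Rightarrow> 'a \<Rightarrow> 'b"
  assumes fin: "finite I" "finite B" "finite S" and "I \<noteq> {}" and "card B \<ge> 2"
    and e: "\<And>c. c \<in> I \<rightarrow>\<^sub>E B \<Longrightarrow> e c \<in> S"
  shows "measure (uniform_count_measure ((I \<rightarrow>\<^sub>E B) \<times> I)) {(c, u) \<in> (I \<rightarrow>\<^sub>E B) \<times> I. g (e c) u \<noteq> c u}
    \<ge> 1 - (log 2 (card S) / card I + 1) / log 2 (card B)"
proof -
  let ?P = "I \<rightarrow>\<^sub>E B"
  let ?W = "{(c, u) \<in> ?P \<times> I. g (e c) u \<noteq> c u}"
  let ?R = "Sigma ?P (\<lambda>c. {u \<in> I. g (e c) u = c u})"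
  have B: "B \<noteq> {}" using \<open>card B \<ge> 2\<close> by auto
  have finP: "finite ?P" using fin by (simp add: finite_PiE)
  have pos: "card ?P > 0" "card I > 0" "log 2 (card B) > 0"
    using finP fin B \<open>I \<noteq> {}\<close> \<open>card B \<ge> 2\<close> by (auto simp: card_gt_0_iff PiE_eq_empty_iff)
  have "card (?W \<union> ?R) = card ?W + card ?R"
    using finP fin by (intro card_Un_disjoint) (auto intro: finite_subset[of _ "?P \<times> I"])
  moreover have "?W \<union> ?R = ?P \<times> I" by auto
  ultimately have "real (card ?P) * card I = card ?W + card ?R"
    by (metis card_cartesian_product of_nat_add of_nat_mult)
  moreover have "real (card ?R) = (\<Sum>c\<in>?P. real (card {u \<in> I. g (e c) u = c u}))"
    using finP fin by (subst card_SigmaI) auto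
  moreover have "\<dots> \<le> real (card ?P) * (log 2 (card S) + card I) / log 2 (card B)"
    using sum_card_agree_le[OF fin B e, where g = g] pos by (simp add: field_simps)
  ultimately have "real (card ?P) * card I - real (card ?P) * (log 2 (card S) + card I) / log 2 (card B)
      \<le> card ?W"
    by linarith
  then have "(real (card ?P) * card I - real (card ?P) * (log 2 (card S) + card I) / log 2 (card B))
      / (real (card ?P) * card I) \<le> card ?W / (real (card ?P) * card I)"
    by (rule divide_right_mono) simp
  also have "(real (card ?P) * card I - real (card ?P) * (log 2 (card S) + card I) / log 2 (card B))
      / (real (card ?P) * card I) = 1 - (log 2 (card S) / card I + 1) / log 2 (card B)"
    using pos by (simp add: field_simps)
  also have "card ?W / (real (card ?P) * card I) = measure (uniform_count_measure (?P \<times> I)) ?W"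
    using finP fin by (subst measure_uniform_count_measure) (auto simp: card_cartesian_product)
  finally show ?thesis .
qed

text \<open>As the seed is independent of stream and query, \<open>err\<close> is the average over
  seeds of the error of a deterministic agent. The bound for the latter does not depend on the seed
  and survives averaging.\<close>

lemma err_ge:
  assumes A: "memory_agent N d K m A" and N: "N \<ge> 1" and d: "d \<ge> 1" and K: "K \<ge> 2"
  shows "err N d K A \<ge> 1 - (real m / (real N * real d) + 1) / log 2 (real K)"
proof -
  define I where "I = attributes N d"
  define P where "P = (I \<rightarrow>\<^sub>E {1..K})"
  define \<beta> where "\<beta> = 1 - (real m / (real N * real d) + 1) / log 2 (real K)"
  have I: "finite I" "I \<noteq> {}" and cardI: "card I = N * d"
    using N d by (auto simp: I_def attributes_def)
  have P: "finite P" "P \<noteq> {}"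
    using I K by (auto simp: P_def PiE_eq_empty_iff intro!: finite_PiE)
  have key: "keyframe_space N d K = uniform_count_measure P"
    unfolding keyframe_space_def P_def I_def[symmetric]
    using I K by (intro PiM_uniform_count_measure) auto
  have task: "task_space N d K A = seed_space A \<Otimes>\<^sub>M uniform_count_measure (P \<times> I)"
    using P I
    by (simp add: task_space_def key query_space_def I_def[symmetric] pair_uniform_count_measure)
  interpret T: prob_space "task_space N d K A"
    using assms by (intro prob_space_task_space) auto
  interpret R: prob_space "seed_space A" using A by (simp add: memory_agent_def)
  interpret CQ: prob_space "uniform_count_measure (P \<times> I)"
    using P I by (intro prob_space_uniform_count_measure) auto
  have finS: "finite {s :: bool list. length s = m}" and cardS: "card {s :: bool list. length s = m} = 2 ^ m"
    using finite_lists_length_eq[of "UNIV :: bool set" m] card_lists_length_eq[of "UNIV :: bool set" m]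
    by simp_all
  have slice: "ennreal \<beta> \<le> emeasure (uniform_count_measure (P \<times> I)) (Pair r -` error_event N d K A)"
    if r: "r \<in> space (seed_space A)" for r
  proof -
    have len: "encode A r c \<in> {s. length s = m}" if "c \<in> I \<rightarrow>\<^sub>E {1..K}" for c
    proof -
      have "(\<lambda>r. encode A r c) \<in> seed_space A \<rightarrow>\<^sub>M count_space {s. length s = m}"
        using A that by (simp add: memory_agent_def key P_def space_uniform_count_measure)
      from measurable_space[OF this r] show ?thesis by simp
    qed
    have "Pair r -` error_event N d K A
        = {(c, u) \<in> P \<times> I. answer A r (encode A r c) u \<noteq> c u}"
      using r by (auto simp: error_event_def task space_pair_measure space_uniform_count_measure)
    moreover have "\<beta> \<le> measure (uniform_count_measure (P \<times> I))
        {(c, u) \<in> P \<times> I. answer A r (encode A r c) u \<noteq> c u}"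
      using measure_disagree_ge[where e = "encode A r" and g = "answer A r" and B = "{1..K}", OF I(1) _ finS I(2) _ len] K
      by (simp add: \<beta>_def cardS cardI P_def log_nat_power)
    ultimately show ?thesis
      by (simp add: CQ.emeasure_eq_measure ennreal_leI)
  qed
  have "ennreal \<beta> = (\<integral>\<^sup>+ r. ennreal \<beta> \<partial>seed_space A)"
    by (simp add: R.emeasure_space_1)
  also have "\<dots> \<le> (\<integral>\<^sup>+ r. emeasure (uniform_count_measure (P \<times> I)) (Pair r -` error_event N d K A)
      \<partial>seed_space A)"
    by (intro nn_integral_mono slice)
  \<comment> \<open>Tonelli, applied to the measurable error event.\<close>
  also have "\<dots> = emeasure (task_space N d K A) (error_event N d K A)"
    using error_event_measurable[OF A] unfolding task
    by (subst CQ.emeasure_pair_measure_alt) auto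
  also have "\<dots> = ennreal (err N d K A)"
    by (simp add: err_def T.emeasure_eq_measure)
  \<comment> \<open>\<open>\<beta>\<close> may be negative, where \<open>ennreal\<close> truncates
    it to 0; the comparison still transfers to the reals because \<open>err\<close> is
    nonnegative.\<close>
  finally show ?thesis
    by (simp add: \<beta>_def err_def ennreal_le_iff)
qed

section \<open>Asymptotics in the number of keyframes\<close>

text \<open>Once \<open>log 2 K\<close> is distributed over the sum, the state size enters only
  through \<open>m N / (N b)\<close>, with \<open>b = d * log 2 K\<close>, which the little-o
  hypothesis sends to 0.\<close>

lemma retrieval_bound_tendsto:
  fixes m :: "nat \<Rightarrow> nat"
  assumes d: "d \<ge> 1" and K: "K \<ge> (2::nat)"
    and o: "(\<lambda>N. real (m N)) \<in> o(\<lambda>N. real N * (real d * log 2 (real K)))"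
  shows "(\<lambda>N. 1 - (real (m N) / (real N * real d) + 1) / log 2 (real K))
      \<longlonglongrightarrow> 1 - 1 / log 2 (real K)"
proof -
  have L: "log 2 (real K) > 0" using K by simp
  have "(\<lambda>N. 1 - (real (m N) / (real N * (real d * log 2 (real K))) + 1 / log 2 (real K)))
      \<longlonglongrightarrow> 1 - (0 + 1 / log 2 (real K))"
    by (intro tendsto_intros smalloD_tendsto[OF o])
  then show ?thesis
    using L by (simp add: add_divide_distrib mult.assoc)
qed

text \<open>An agent may err more often than the bound and its error need not converge, so the limit
  of the bound only passes to the \<open>liminf\<close>.\<close>

lemma liminf_err_ge:
  assumes d: "d \<ge> 1" and K: "K \<ge> 2"
    and A: "\<And>N. N \<ge> 1 \<Longrightarrow> memory_agent N d K (m N) (A N)"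
    and o: "(\<lambda>N. real (m N)) \<in> o(\<lambda>N. real N * (real d * log 2 (real K)))"
  shows "liminf (\<lambda>N. ereal (err N d K (A N))) \<ge> ereal (1 - 1 / log 2 (real K))"
proof -
  let ?\<beta> = "\<lambda>N. 1 - (real (m N) / (real N * real d) + 1) / log 2 (real K)"
  have "ereal (1 - 1 / log 2 (real K)) = liminf (\<lambda>N. ereal (?\<beta> N))"
    using retrieval_bound_tendsto[OF d K o]
    by (intro lim_imp_Liminf[symmetric]) auto
  also have "\<dots> \<le> liminf (\<lambda>N. ereal (err N d K (A N)))"
  proof (rule Liminf_mono)
    \<comment> \<open>The bound on \<open>err\<close> is available from \<open>N = 1\<close> on,
      hence an eventual comparison.\<close>
    show "\<forall>\<^sub>F N in sequentially. ereal (?\<beta> N) \<le> ereal (err N d K (A N))"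
      using eventually_ge_at_top[of 1] by eventually_elim (simp add: err_ge[OF A _ d K])
  qed
  finally show ?thesis .
qed

theorem theorem1:
  fixes K d :: nat
  assumes "K \<ge> 2" and "d \<ge> 1"
  shows "(\<forall>N m (A :: 'r agent). N \<ge> 1 \<longrightarrow> memory_agent N d K m A \<longrightarrow>
            err N d K A \<ge> 1 - (real m / (real N * real d) + 1) / log 2 (real K))
       \<and> (\<forall>(m :: nat \<Rightarrow> nat) (A :: nat \<Rightarrow> 'r agent).
            (\<forall>N\<ge>1. memory_agent N d K (m N) (A N)) \<longrightarrow>
            (\<lambda>N. real (m N)) \<in> o(\<lambda>N. real N * (real d * log 2 (real K))) \<longrightarrow>
              ((\<lambda>N. 1 - (real (m N) / (real N * real d) + 1) / log 2 (real K))
                 \<longlonglongrightarrow> 1 - 1 / log 2 (real K))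
            \<and> liminf (\<lambda>N. ereal (err N d K (A N))) \<ge> ereal (1 - 1 / log 2 (real K)))
       \<and> (\<forall>(m :: nat) (A :: nat \<Rightarrow> 'r agent).
            (\<forall>N\<ge>1. memory_agent N d K m (A N)) \<longrightarrow>
              liminf (\<lambda>N. ereal (err N d K (A N))) \<ge> ereal (1 - 1 / log 2 (real K)))"
proof (intro conjI allI impI)
  fix N m and A :: "'r agent"
  assume "N \<ge> 1" "memory_agent N d K m A"
  then show "err N d K A \<ge> 1 - (real m / (real N * real d) + 1) / log 2 (real K)"
    using assms by (intro err_ge)
next
  fix m :: "nat \<Rightarrow> nat" and A :: "nat \<Rightarrow> 'r agent"
  assume A: "\<forall>N\<ge>1. memory_agent N d K (m N) (A N)"
    and o: "(\<lambda>N. real (m N)) \<in> o(\<lambda>N. real N * (real d * log 2 (real K)))"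
  show "(\<lambda>N. 1 - (real (m N) / (real N * real d) + 1) / log 2 (real K))
      \<longlonglongrightarrow> 1 - 1 / log 2 (real K)"
    using assms o by (intro retrieval_bound_tendsto)
  show "liminf (\<lambda>N. ereal (err N d K (A N))) \<ge> ereal (1 - 1 / log 2 (real K))"
    using assms A o by (intro liminf_err_ge) auto
next
  fix m :: nat and A :: "nat \<Rightarrow> 'r agent"
  assume A: "\<forall>N\<ge>1. memory_agent N d K m (A N)"
  have "real d * log 2 (real K) > 0"
    using assms by (intro mult_pos_pos) auto
  \<comment> \<open>A constant is dominated by a linear function of positive slope; the slope
    \<open>d * log 2 K\<close> is generalised to \<open>x\<close> to give \<open>real_asymp\<close>
    a plain linear growth.\<close>
  moreover have "(\<lambda>N. real m) \<in> o(\<lambda>N. real N * x)" if "x > 0" for x :: real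
    using that by real_asymp
  ultimately have "(\<lambda>N. real m) \<in> o(\<lambda>N. real N * (real d * log 2 (real K)))"
    by blast
  then show "liminf (\<lambda>N. ereal (err N d K (A N))) \<ge> ereal (1 - 1 / log 2 (real K))"
    using assms A by (intro liminf_err_ge[where m = "\<lambda>_. m"]) auto
qed

end
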